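(* Let $(\lambda,x)$ be an eigenpair of a Hermitian matrix $A\in\mathbb{C}^{n\times n}$ and let $(\theta,v)$ be a harmonic Ritz pair of $A$ with respect to a subspace $\mathcal{K}\subseteq\mathbb{C}^n$ and a (real) shift $\sigma\notin\Lambda(A)$. Let $\Theta$ be the set of all the harmonic Ritz values and let $P_{\mathcal{Q}}$ be the orthogonal projector onto $\mathcal{Q}=(A-\sigma I)\mathcal{K}$. Then $$\sin\angle(x,v)\le \kappa(A-\sigma I)\sqrt{1+\frac{\gamma^2}{\delta^2}}\;\sin\angle(x,\mathcal{K}),$$ where $\gamma=\|P_{\mathcal{Q}}(A-\sigma I)^{-1}(I-P_{\mathcal{Q}})\|$, $$\kappa(A-\sigma I)=\frac{\max_{\lambda_j\in\Lambda(A)}|\lambda_j-\sigma|}{\min_{\lambda_j\in\Lambda(A)}|\lambda_j-\sigma|},\qquad \delta=\min_{\theta_j\in\Theta\setminus\theta}\left|\frac{\theta_j-\lambda}{(\lambda-\sigma)(\theta_j-\sigma)}\right|.$$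
   Context: $\Lambda(A)$ is the spectrum of $A$. For nonzero vectors, $\angle(x,y)\in[0,\pi/2]$ is defined by $\cos\angle(x,y)=|x^*y|/(\|x\|\|y\|)$, and $\angle(x,\mathcal{K})=\min_{y\in\mathcal{K},\,y\ne0}\angle(x,y)$. The matrix norm $\|\cdot\|$ is either the spectral or the Frobenius norm. Harmonic Ritz pairs of $A$ with respect to $\mathcal{K}$ and $\sigma$ are the pairs $(\theta,v)$ with $v\in\mathcal{K}$, $v\neq0$, and $Av-\theta v\perp(A-\sigma I)\mathcal{K}$. Equivalently, if $K$ is a matrix whose columns form a basis of $\mathcal{K}$, the eigenpairs $(\xi,c)$ of $K^*(A-\sigma I)^2Kc=\xi\,K^*(A-\sigma I)Kc$ yield the harmonic Ritz value $\theta=\xi+\sigma$ and the harmonic Ritz vector $v=Kc$. In the set $\Theta$, multiple harmonic Ritz values are repeated; $\Theta\setminus\theta$ is $\Theta$ with the value $\theta$ of the pair $(\theta,v)$ removed.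
   Formalization: If K*(A−σI)K is singular, Θ also includes the infinite harmonic Ritz values, each contributing |1/(λ−σ)| to δ (without them the bound can fail); δ is assumed nonzero, and δ = ∞ when Θ∖θ is empty. *)

theory Defs
  imports "HOL-Analysis.Analysis" "HOL-Library.Multiset"
begin

definition cinner :: "complex^'n \<Rightarrow> complex^'n \<Rightarrow> complex" where
  "cinner x y = (\<Sum>i\<in>UNIV. cnj (x $ i) * y $ i)"

definition conj_transpose :: "complex^'n^'m \<Rightarrow> complex^'m^'n" where
  "conj_transpose A = (\<chi> i j. cnj (A $ j $ i))"

definition hermitian :: "complex^'n^'n \<Rightarrow> bool" where
  "hermitian A \<longleftrightarrow> conj_transpose A = A"

definition eigenpair :: "complex^'n^'n \<Rightarrow> complex \<Rightarrow> complex^'n \<Rightarrow> bool" where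
  "eigenpair A \<mu> x \<longleftrightarrow> x \<noteq> 0 \<and> A *v x = \<mu> *s x"

definition spectrum :: "complex^'n^'n \<Rightarrow> complex set" where
  "spectrum A = {\<mu>. \<exists>x. eigenpair A \<mu> x}"

text \<open>The angle between the lines spanned by nonzero \<open>x\<close> and \<open>y\<close>; by Cauchy--Schwarz the
  argument of \<open>arccos\<close> lies in \<open>[0, 1]\<close>, so the value lies in \<open>[0, pi/2]\<close>.\<close>

definition cangle :: "complex^'n \<Rightarrow> complex^'n \<Rightarrow> real" where
  "cangle x y = arccos (cmod (cinner x y) / (norm x * norm y))"

text \<open>For a nonzero subspace the infimum is attained, so it is the minimum.\<close>

definition cangle_space :: "complex^'n \<Rightarrow> (complex^'n) set \<Rightarrow> real" where
  "cangle_space x K = (INF y\<in>K - {0}. cangle x y)"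

definition orthogonal_projector :: "complex^'n^'n \<Rightarrow> (complex^'n) set \<Rightarrow> bool" where
  "orthogonal_projector P Q \<longleftrightarrow> P ** P = P \<and> hermitian P \<and> range ((*v) P) = Q"

text \<open>The matrix \<open>A - \<sigma> I\<close>.\<close>

definition shifted :: "complex^'n^'n \<Rightarrow> real \<Rightarrow> complex^'n^'n" where
  "shifted A \<sigma> = A - mat (complex_of_real \<sigma>)"

definition kappa_shifted :: "complex^'n^'n \<Rightarrow> real \<Rightarrow> real" where
  "kappa_shifted A \<sigma> =
     Max ((\<lambda>\<mu>. cmod (\<mu> - complex_of_real \<sigma>)) ` spectrum A) /
     Min ((\<lambda>\<mu>. cmod (\<mu> - complex_of_real \<sigma>)) ` spectrum A)"

definition harmonic_ritz_pair ::
  "complex^'n^'n \<Rightarrow> real \<Rightarrow> (complex^'n) set \<Rightarrow> complex \<Rightarrow> complex^'n \<Rightarrow> bool" where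
  "harmonic_ritz_pair A \<sigma> K \<theta> v \<longleftrightarrow>
     v \<in> K \<and> v \<noteq> 0 \<and> (\<forall>q \<in> (*v) (shifted A \<sigma>) ` K. cinner q (A *v v - \<theta> *s v) = 0)"

text \<open>With a basis matrix \<open>K\<close>, the harmonic Ritz values are the eigenvalues (shifted by \<open>\<sigma>\<close>) of the
  pencil \<open>K\<^sup>* (A - \<sigma> I)\<^sup>2 K c = \<xi> K\<^sup>* (A - \<sigma> I) K c\<close>. The matrix on the right may be singular,
  and then the pencil also has the eigenvalue infinity, with eigenvectors \<open>c\<close> such that
  \<open>K\<^sup>* (A - \<sigma> I) K c = 0\<close>, i.e. \<open>v = K c\<close> orthogonal to \<open>(A - \<sigma> I) K\<close>.\<close>

datatype ritz_value = Finite complex | Infinite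

fun harmonic_ritz_space ::
  "complex^'n^'n \<Rightarrow> real \<Rightarrow> (complex^'n) set \<Rightarrow> ritz_value \<Rightarrow> (complex^'n) set" where
  "harmonic_ritz_space A \<sigma> K (Finite \<theta>) = {v. v = 0 \<or> harmonic_ritz_pair A \<sigma> K \<theta> v}"
| "harmonic_ritz_space A \<sigma> K Infinite =
     {v \<in> K. \<forall>q \<in> (*v) (shifted A \<sigma>) ` K. cinner q v = 0}"

text \<open>Each harmonic Ritz value is repeated according to its multiplicity. The left-hand matrix of the
  pencil is positive definite and the right-hand one Hermitian, so geometric and algebraic
  multiplicities agree.\<close>

definition harmonic_ritz_values ::
  "complex^'n^'n \<Rightarrow> real \<Rightarrow> (complex^'n) set \<Rightarrow> ritz_value multiset" where
  "harmonic_ritz_values A \<sigma> K = Abs_multiset (\<lambda>t. vec.dim (harmonic_ritz_space A \<sigma> K t))"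

text \<open>The value at infinity is the limit, equal to \<open>\<bar>1 / (\<lambda> - \<sigma>) - 0\<bar>\<close>.\<close>

fun ritz_gap :: "complex \<Rightarrow> real \<Rightarrow> ritz_value \<Rightarrow> real" where
  "ritz_gap \<mu> \<sigma> (Finite \<theta>) =
     cmod ((\<theta> - \<mu>) / ((\<mu> - complex_of_real \<sigma>) * (\<theta> - complex_of_real \<sigma>)))"
| "ritz_gap \<mu> \<sigma> Infinite = cmod (1 / (\<mu> - complex_of_real \<sigma>))"

text \<open>Multiset difference removes a single copy of \<open>\<theta>\<close>. If nothing is left, that is if \<open>K\<close> is
  one-dimensional, the minimum over the empty set is \<open>\<infinity>\<close>.\<close>

definition ritz_separation ::
  "complex^'n^'n \<Rightarrow> real \<Rightarrow> (complex^'n) set \<Rightarrow> complex \<Rightarrow> complex \<Rightarrow> ereal" where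
  "ritz_separation A \<sigma> K \<mu> \<theta> =
     (INF t \<in> set_mset (harmonic_ritz_values A \<sigma> K - {#Finite \<theta>#}). ereal (ritz_gap \<mu> \<sigma> t))"


subsection \<open>Finiteness of the spectrum and of the harmonic Ritz values\<close>

lemma Re_cinner: "Re (cinner x y) = x \<bullet> y"
  by (simp add: cinner_def inner_vec_def inner_complex_def)

lemma cinner_commute: "cinner y x = cnj (cinner x y)"
  by (simp add: cinner_def mult.commute)

lemma cinner_add_right: "cinner x (y + z) = cinner x y + cinner x z"
  by (simp add: cinner_def sum.distrib algebra_simps)

lemma cinner_diff_right: "cinner x (y - z) = cinner x y - cinner x z"
  by (simp add: cinner_def sum_subtractf algebra_simps)

lemma cinner_scale_right: "cinner x (c *s y) = c * cinner x y"
  by (simp add: cinner_def sum_distrib_left algebra_simps)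

lemma cinner_scale_left: "cinner (c *s x) y = cnj c * cinner x y"
  by (simp add: cinner_def sum_distrib_left algebra_simps)

lemma cinner_self: "cinner x x = complex_of_real ((norm x)\<^sup>2)"
proof (rule complex_eqI)
  show "Re (cinner x x) = Re (complex_of_real ((norm x)\<^sup>2))"
    by (simp add: Re_cinner power2_norm_eq_inner)
  have "cnj (cinner x x) = cinner x x" by (metis cinner_commute)
  then have "Im (cinner x x) = 0" by (simp add: complex_eq_iff)
  then show "Im (cinner x x) = Im (complex_of_real ((norm x)\<^sup>2))" by simp
qed

lemma cinner_hermitian:
  assumes "hermitian A"
  shows "cinner (A *v x) y = cinner x (A *v y)"
proof -
  have A: "cnj (A $ i $ j) = A $ j $ i" for i j
  proof -
    have "conj_transpose A $ j $ i = A $ j $ i" using assms by (simp add: hermitian_def)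
    then show ?thesis by (simp add: conj_transpose_def)
  qed
  have "cinner (A *v x) y = (\<Sum>i\<in>UNIV. \<Sum>j\<in>UNIV. A $ j $ i * cnj (x $ j) * y $ i)"
    by (simp add: cinner_def matrix_vector_mult_def sum_distrib_right A)
  also have "\<dots> = (\<Sum>j\<in>UNIV. \<Sum>i\<in>UNIV. A $ j $ i * cnj (x $ j) * y $ i)"
    by (rule sum.swap)
  also have "\<dots> = cinner x (A *v y)"
    by (simp add: cinner_def matrix_vector_mult_def sum_distrib_left mult_ac)
  finally show ?thesis .
qed

lemma hermitian_shifted:
  assumes "hermitian A"
  shows "hermitian (shifted A \<sigma>)"
proof -
  have A: "cnj (A $ i $ j) = A $ j $ i" for i j
  proof -
    have "conj_transpose A $ j $ i = A $ j $ i" using assms by (simp add: hermitian_def)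
    then show ?thesis by (simp add: conj_transpose_def)
  qed
  show ?thesis
    by (simp add: hermitian_def conj_transpose_def shifted_def vec_eq_iff A mat_def)
qed

lemma shifted_mult: "shifted A \<sigma> *v x = A *v x - complex_of_real \<sigma> *s x"
proof -
  have "mat c *v x = c *s x" for c :: complex
    by (simp add: matrix_vector_mult_def mat_def vec_eq_iff if_distrib if_distribR cong: if_cong)
  then show ?thesis
    by (simp add: shifted_def matrix_vector_mult_diff_rdistrib)
qed

lemma finite_orthogonal_family:
  fixes f :: "'a \<Rightarrow> complex^'n"
  assumes nz: "\<And>s. s \<in> S \<Longrightarrow> f s \<noteq> 0"
    and orth: "\<And>s t. s \<in> S \<Longrightarrow> t \<in> S \<Longrightarrow> s \<noteq> t \<Longrightarrow> cinner (f s) (f t) = 0"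
  shows "finite S"
proof -
  have o: "f s \<bullet> f t = 0" if "s \<in> S" "t \<in> S" "s \<noteq> t" for s t
    using orth[OF that] by (metis Re_cinner zero_complex.simps(1))
  have inj: "inj_on f S"
    by (rule inj_onI) (metis o nz inner_eq_zero_iff)
  have "pairwise orthogonal (f ` S)"
    unfolding pairwise_def orthogonal_def using o by auto
  moreover have "0 \<notin> f ` S" using nz by auto
  ultimately have "independent (f ` S)" by (rule pairwise_orthogonal_independent)
  then have "finite (f ` S)" using independent_bound by blast
  then show ?thesis using inj by (simp add: finite_image_iff)
qed

lemma finite_spectrum:
  assumes "hermitian A"
  shows "finite (spectrum A)"
proof -
  have "\<exists>f. \<forall>\<mu>\<in>spectrum A. eigenpair A \<mu> (f \<mu>)"
    unfolding spectrum_def by (intro bchoice) auto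
  then obtain f where f: "\<And>\<mu>. \<mu> \<in> spectrum A \<Longrightarrow> f \<mu> \<noteq> 0 \<and> A *v f \<mu> = \<mu> *s f \<mu>"
    unfolding eigenpair_def by auto
  have e: "cnj s * cinner (f s) (f t) = t * cinner (f s) (f t)"
    if "s \<in> spectrum A" "t \<in> spectrum A" for s t
    using cinner_hermitian[OF assms, of "f s" "f t"] f[OF that(1)] f[OF that(2)]
    by (simp add: cinner_scale_left cinner_scale_right)
  have r: "cnj s = s" if "s \<in> spectrum A" for s
    using e[OF that that] f[OF that] by (simp add: cinner_self)
  show ?thesis
    by (rule finite_orthogonal_family[of _ f]) (use f e r in auto)
qed

lemma harmonic_ritz_pair_iff:
  "harmonic_ritz_pair A \<sigma> K \<theta> v \<longleftrightarrow> v \<in> K \<and> v \<noteq> 0 \<and>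
     (\<forall>w\<in>K. cinner (shifted A \<sigma> *v w) (shifted A \<sigma> *v v) =
        (\<theta> - complex_of_real \<sigma>) * cinner (shifted A \<sigma> *v w) v)"
  by (auto simp: harmonic_ritz_pair_def shifted_mult cinner_diff_right cinner_scale_right
      algebra_simps)

lemma finite_harmonic_ritz_values:
  assumes "hermitian A" "complex_of_real \<sigma> \<notin> spectrum A"
  shows "finite {\<theta>. \<exists>v. harmonic_ritz_pair A \<sigma> K \<theta> v}" (is "finite ?S")
proof -
  define B where "B = shifted A \<sigma>"
  have Bh: "hermitian B" unfolding B_def by (rule hermitian_shifted) fact
  have "\<exists>f. \<forall>\<theta>\<in>?S. harmonic_ritz_pair A \<sigma> K \<theta> (f \<theta>)"
    by (intro bchoice) auto
  then obtain f where f: "\<And>\<theta>. \<theta> \<in> ?S \<Longrightarrow> harmonic_ritz_pair A \<sigma> K \<theta> (f \<theta>)"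
    by blast
  have fK: "f s \<in> K" if "s \<in> ?S" for s
    using f[OF that] by (simp add: harmonic_ritz_pair_iff)
  have nz: "B *v f s \<noteq> 0" if "s \<in> ?S" for s
  proof
    assume "B *v f s = 0"
    then have "A *v f s = complex_of_real \<sigma> *s f s" by (simp add: B_def shifted_mult)
    moreover have "f s \<noteq> 0" using f[OF that] by (simp add: harmonic_ritz_pair_iff)
    ultimately show False using assms(2) by (auto simp: spectrum_def eigenpair_def)
  qed
  define c where "c = (\<lambda>s. s - complex_of_real \<sigma>)"
  have e: "cinner (B *v f s) (B *v f t) = c t * cinner (B *v f s) (f t)"
    if "s \<in> ?S" "t \<in> ?S" for s t
    using f[OF that(2)] fK[OF that(1)] by (simp add: harmonic_ritz_pair_iff B_def c_def)
  have e': "cinner (B *v f s) (B *v f t) = cnj (c s) * cinner (B *v f s) (f t)"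
    if "s \<in> ?S" "t \<in> ?S" for s t
  proof -
    have "cinner (B *v f s) (B *v f t) = cnj (c s) * cnj (cinner (B *v f t) (f s))"
      using e[OF that(2,1)] by (metis cinner_commute complex_cnj_mult)
    also have "cnj (cinner (B *v f t) (f s)) = cinner (f s) (B *v f t)"
      by (metis cinner_commute)
    finally show ?thesis by (simp add: cinner_hermitian[OF Bh])
  qed
  have r: "cnj (c s) = c s" if "s \<in> ?S" for s
  proof -
    have "cinner (B *v f s) (B *v f s) \<noteq> 0" using nz[OF that] by (simp add: cinner_self)
    then show ?thesis using e[OF that that] e'[OF that that] by auto
  qed
  have orth: "cinner (B *v f s) (B *v f t) = 0" if st: "s \<in> ?S" "t \<in> ?S" "s \<noteq> t" for s t
  proof -
    have "c s \<noteq> c t" using st(3) by (simp add: c_def)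
    moreover have "c t * cinner (B *v f s) (f t) = c s * cinner (B *v f s) (f t)"
      using e[OF st(1,2)] e'[OF st(1,2)] r[OF st(1)] by metis
    ultimately have "cinner (B *v f s) (f t) = 0" by auto
    then show ?thesis using e[OF st(1,2)] by simp
  qed
  show ?thesis
    by (rule finite_orthogonal_family[of _ "\<lambda>s. B *v f s"]) (use nz orth in blast)+
qed

lemma count_harmonic_ritz_values:
  assumes "hermitian A" "complex_of_real \<sigma> \<notin> spectrum A"
  shows "count (harmonic_ritz_values A \<sigma> K) t = vec.dim (harmonic_ritz_space A \<sigma> K t)"
proof -
  let ?d = "\<lambda>t. vec.dim (harmonic_ritz_space A \<sigma> K t)"
  have "{t. 0 < ?d t} \<subseteq> insert Infinite (Finite ` {\<theta>. \<exists>v. harmonic_ritz_pair A \<sigma> K \<theta> v})"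
  proof
    fix t assume t: "t \<in> {t. 0 < ?d t}"
    show "t \<in> insert Infinite (Finite ` {\<theta>. \<exists>v. harmonic_ritz_pair A \<sigma> K \<theta> v})"
    proof (cases t)
      case (Finite \<theta>)
      have "\<exists>v. harmonic_ritz_pair A \<sigma> K \<theta> v"
      proof (rule ccontr)
        assume "\<nexists>v. harmonic_ritz_pair A \<sigma> K \<theta> v"
        then have "harmonic_ritz_space A \<sigma> K t = {0}" using Finite by auto
        then show False using t by simp
      qed
      then show ?thesis using Finite by auto
    qed simp
  qed
  then have "finite {t. 0 < ?d t}"
    by (rule finite_subset) (simp add: finite_harmonic_ritz_values[OF assms])
  then show ?thesis
    by (simp add: harmonic_ritz_values_def)
qed

end

theory Submission imports Defs begin

text \<open>With \<open>B = A - \<sigma> I\<close>, the vector \<open>w = B v\<close> is a Ritz vector of \<open>B\<^sup>-\<^sup>1\<close> with respect to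
  \<open>Q = B K\<close>, and \<open>\<delta>\<close> is the distance from \<open>1 / (\<lambda> - \<sigma>)\<close> to the other Ritz values, so Saad's bound
  compares \<open>\<angle>(x, w)\<close> with \<open>\<angle>(x, Q)\<close>. As \<open>B\<close> fixes the line of \<open>x\<close> and its orthogonal complement,
  passing from \<open>K\<close> to \<open>Q\<close> costs a factor \<open>max \<bar>\<lambda>\<^sub>j - \<sigma>\<bar> / \<bar>\<lambda> - \<sigma>\<bar>\<close>, and passing from \<open>w\<close> back to \<open>v\<close>
  a factor \<open>\<bar>\<lambda> - \<sigma>\<bar> / min \<bar>\<lambda>\<^sub>j - \<sigma>\<bar>\<close>; their product is \<open>\<kappa>(B)\<close>.\<close>

section \<open>Extremal eigenvectors of symmetric maps on an invariant subspace\<close>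

text \<open>The eigenvector is a minimizer \<open>z\<close> of the quadratic form on the unit sphere
  of \<open>S\<close>, which exists by compactness. Moving from \<open>z\<close> along the residual
  \<open>g = f z - r z\<close> changes the form to first order by
  \<open>2 t (g \<bullet> g)\<close>, so minimality forces \<open>g = 0\<close>.\<close>

lemma symmetric_eigen_min:
  fixes f :: "'a::euclidean_space \<Rightarrow> 'a"
  assumes f: "linear f" and S: "subspace S" and inv: "\<And>x. x \<in> S \<Longrightarrow> f x \<in> S"
    and sym: "\<And>x y. x \<in> S \<Longrightarrow> y \<in> S \<Longrightarrow> f x \<bullet> y = x \<bullet> f y"
    and ne: "S \<noteq> {0}"
  obtains z r where "z \<in> S" "z \<noteq> 0" "f z = r *\<^sub>R z" "\<And>y. y \<in> S \<Longrightarrow> r * (y \<bullet> y) \<le> y \<bullet> f y"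
proof -
  have "0 \<in> S" using S by (simp add: subspace_0)
  with ne obtain a where a: "a \<in> S" "a \<noteq> 0" by auto
  have "compact (sphere 0 1 \<inter> S)"
    by (intro compact_Int_closed compact_sphere closed_subspace S)
  moreover have "a /\<^sub>R norm a \<in> sphere 0 1 \<inter> S"
    using a S by (simp add: subspace_scale)
  moreover have "continuous_on (sphere 0 1 \<inter> S) (\<lambda>y. y \<bullet> f y)"
    using linear_continuous_on[OF linear_conv_bounded_linear[THEN iffD1, OF f]]
    by (intro continuous_on_inner continuous_on_id)
  ultimately obtain z where z: "z \<in> sphere 0 1 \<inter> S"
    and zmin: "\<And>y. y \<in> sphere 0 1 \<inter> S \<Longrightarrow> z \<bullet> f z \<le> y \<bullet> f y"
    by (metis continuous_attains_inf empty_iff)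
  define r where "r = z \<bullet> f z"
  have zz: "z \<bullet> z = 1" using z by (simp add: norm_eq_1)
  have min: "r * (y \<bullet> y) \<le> y \<bullet> f y" if y: "y \<in> S" for y
  proof (cases "y = 0")
    case False
    have "y /\<^sub>R norm y \<in> sphere 0 1 \<inter> S"
      using False y S by (simp add: subspace_scale)
    from zmin[OF this] have "r \<le> (y \<bullet> f y) / (norm y)\<^sup>2"
      by (simp add: r_def linear_scale[OF f] power2_eq_square field_simps)
    then show ?thesis using False
      by (simp add: power2_norm_eq_inner[symmetric] field_simps)
  qed (simp add: linear_0[OF f])
  define g where "g = f z - r *\<^sub>R z"
  have gS: "g \<in> S" and zS: "z \<in> S"
    using z inv S by (auto simp: g_def subspace_diff subspace_scale)
  define c where "c = g \<bullet> f g - r * (g \<bullet> g)"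
  have c0: "c \<ge> 0" using min[OF gS] by (simp add: c_def)
  have q: "0 \<le> 2 * t * (g \<bullet> g) + t\<^sup>2 * c" for t
  proof -
    have "z + t *\<^sub>R g \<in> S" using gS zS S by (simp add: subspace_add subspace_scale)
    from min[OF this] have "0 \<le> (z + t *\<^sub>R g) \<bullet> f (z + t *\<^sub>R g) - r * ((z + t *\<^sub>R g) \<bullet> (z + t *\<^sub>R g))"
      by simp
    also have "\<dots> = (z \<bullet> f z - r * (z \<bullet> z)) + 2 * t * (g \<bullet> f z - r * (g \<bullet> z)) + t\<^sup>2 * c"
      using sym[OF zS gS]
      by (simp add: c_def linear_add[OF f] linear_scale[OF f] inner_add inner_commute
          power2_eq_square algebra_simps)
    also have "z \<bullet> f z - r * (z \<bullet> z) = 0" by (simp add: zz r_def)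
    also have "g \<bullet> f z - r * (g \<bullet> z) = g \<bullet> g"
      by (simp add: g_def inner_diff_right)
    finally show ?thesis by simp
  qed
  \<comment> \<open>At this \<open>t\<close> the quadratic in \<open>q\<close> equals a negative
    multiple of the square of \<open>G = g \<bullet> g\<close>. The summand 1 keeps the denominator
    positive when \<open>c = 0\<close>.\<close>
  have "2 * t * G + t\<^sup>2 * c = G\<^sup>2 * (- 2 * (c + 1) + c) / (c + 1)\<^sup>2"
    if "t = - G / (c + 1)" for t G
    unfolding that using c0
    by (simp add: power2_eq_square divide_simps) (simp add: algebra_simps)
  from this[OF refl, of "g \<bullet> g"] q[of "- (g \<bullet> g) / (c + 1)"]
  have "0 \<le> (g \<bullet> g)\<^sup>2 * (- 2 * (c + 1) + c) / (c + 1)\<^sup>2" by metis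
  then have "g \<bullet> g = 0"
    using c0 by (auto simp: zero_le_divide_iff zero_le_mult_iff)
  then have "f z = r *\<^sub>R z" by (simp add: g_def)
  moreover have "z \<noteq> 0" using zz by auto
  ultimately show thesis using that zS min by blast
qed

text \<open>\<open>f z + sqrt s z\<close> is an eigenvector of \<open>f\<close> for \<open>sqrt s\<close>, unless \<open>f z = - sqrt s z\<close>.\<close>

lemma symmetric_eigen_sqrt:
  fixes f :: "'a::euclidean_space \<Rightarrow> 'a"
  assumes f: "linear f" and S: "subspace S" and inv: "\<And>x. x \<in> S \<Longrightarrow> f x \<in> S"
    and sym: "\<And>x y. x \<in> S \<Longrightarrow> y \<in> S \<Longrightarrow> f x \<bullet> y = x \<bullet> f y"
    and z: "z \<in> S" "z \<noteq> 0" "f (f z) = s *\<^sub>R z"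
  obtains z' r where "z' \<in> S" "z' \<noteq> 0" "f z' = r *\<^sub>R z'" "s = r\<^sup>2"
proof -
  have "f z \<bullet> f z = s * (z \<bullet> z)"
    using sym[OF z(1) inv[OF z(1)]] z by simp
  then have "s \<ge> 0" using z(2)
    by (metis inner_ge_zero inner_gt_zero_iff mult.commute zero_le_mult_iff not_less)
  then have ss: "(sqrt s)\<^sup>2 = s" by simp
  show thesis
  proof (cases "f z + sqrt s *\<^sub>R z = 0")
    case True
    then have "f z = (- sqrt s) *\<^sub>R z" by (simp add: add_eq_0_iff)
    then show thesis using that[of z "- sqrt s"] z ss by simp
  next
    case False
    have "f (f z + sqrt s *\<^sub>R z) = sqrt s *\<^sub>R (f z + sqrt s *\<^sub>R z)"
      using ss by (simp add: linear_add[OF f] linear_scale[OF f] z(3) scaleR_add_right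
          power2_eq_square)
    then show thesis
      using that[of "f z + sqrt s *\<^sub>R z" "sqrt s"] False z inv ss S
      by (simp add: subspace_add subspace_scale)
  qed
qed

text \<open>By symmetry the quadratic form of \<open>f \<circ> f\<close> is the squared norm of
  \<open>f y\<close>, so its minimizing eigenvector gives the sharp lower bound; a square root then
  leads back to an eigenvector of \<open>f\<close> itself.\<close>

lemma symmetric_eigen_norm_lower:
  fixes f :: "'a::euclidean_space \<Rightarrow> 'a"
  assumes f: "linear f" and S: "subspace S" and inv: "\<And>x. x \<in> S \<Longrightarrow> f x \<in> S"
    and sym: "\<And>x y. x \<in> S \<Longrightarrow> y \<in> S \<Longrightarrow> f x \<bullet> y = x \<bullet> f y"
    and ne: "S \<noteq> {0}"
  obtains z r where "z \<in> S" "z \<noteq> 0" "f z = r *\<^sub>R z" "\<And>y. y \<in> S \<Longrightarrow> \<bar>r\<bar> * norm y \<le> norm (f y)"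
proof -
  have "linear (\<lambda>x. f (f x))" using linear_compose[OF f f] by (simp add: o_def)
  then obtain z s where z: "z \<in> S" "z \<noteq> 0" "f (f z) = s *\<^sub>R z"
    and s: "\<And>y. y \<in> S \<Longrightarrow> s * (y \<bullet> y) \<le> y \<bullet> f (f y)"
    by (rule symmetric_eigen_min[OF _ S _ _ ne]) (simp_all add: inv sym)
  obtain z' r where z': "z' \<in> S" "z' \<noteq> 0" "f z' = r *\<^sub>R z'" and r: "s = r\<^sup>2"
    by (rule symmetric_eigen_sqrt[OF f S inv sym z])
  have "\<bar>r\<bar> * norm y \<le> norm (f y)" if "y \<in> S" for y
  proof (rule power2_le_imp_le)
    have "y \<bullet> f (f y) = f y \<bullet> f y" using that by (simp add: sym inv)
    then show "(\<bar>r\<bar> * norm y)\<^sup>2 \<le> (norm (f y))\<^sup>2"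
      using s[OF that] r by (simp add: power_mult_distrib power2_norm_eq_inner)
  qed simp
  with z' show thesis using that by blast
qed

text \<open>The same argument for \<open>- f (f x)\<close>, whose minimum is the maximum of the
  squared norm with the sign reversed.\<close>

lemma symmetric_eigen_norm_upper:
  fixes f :: "'a::euclidean_space \<Rightarrow> 'a"
  assumes f: "linear f" and S: "subspace S" and inv: "\<And>x. x \<in> S \<Longrightarrow> f x \<in> S"
    and sym: "\<And>x y. x \<in> S \<Longrightarrow> y \<in> S \<Longrightarrow> f x \<bullet> y = x \<bullet> f y"
    and ne: "S \<noteq> {0}"
  obtains z r where "z \<in> S" "z \<noteq> 0" "f z = r *\<^sub>R z" "\<And>y. y \<in> S \<Longrightarrow> norm (f y) \<le> \<bar>r\<bar> * norm y"
proof -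
  have "linear (\<lambda>x. - f (f x))"
    using linear_compose_neg[OF linear_compose[OF f f]] by (simp add: o_def)
  then obtain z s where z: "z \<in> S" "z \<noteq> 0" "- f (f z) = s *\<^sub>R z"
    and s: "\<And>y. y \<in> S \<Longrightarrow> s * (y \<bullet> y) \<le> y \<bullet> (- f (f y))"
    by (rule symmetric_eigen_min[OF _ S _ _ ne]) (simp_all add: inv sym subspace_neg[OF S])
  have z3: "f (f z) = (- s) *\<^sub>R z" using z(3) by (metis add.inverse_inverse scaleR_minus_left)
  obtain z' r where z': "z' \<in> S" "z' \<noteq> 0" "f z' = r *\<^sub>R z'" and r: "- s = r\<^sup>2"
    by (rule symmetric_eigen_sqrt[OF f S inv sym z(1,2) z3])
  have "norm (f y) \<le> \<bar>r\<bar> * norm y" if "y \<in> S" for y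
  proof (rule power2_le_imp_le)
    have "y \<bullet> f (f y) = f y \<bullet> f y" using that by (simp add: sym inv)
    then show "(norm (f y))\<^sup>2 \<le> (\<bar>r\<bar> * norm y)\<^sup>2"
      using s[OF that] r[symmetric] by (simp add: power_mult_distrib power2_norm_eq_inner)
  qed simp
  with z' show thesis using that by blast
qed

section \<open>Complex inner product, norms and orthogonality\<close>

lemma cinner_zero_left [simp]: "cinner 0 y = 0"
  and cinner_zero_right [simp]: "cinner x 0 = 0"
  by (simp_all add: cinner_def)

lemma cinner_eq_0_imp_inner: "cinner x y = 0 \<Longrightarrow> x \<bullet> y = 0"
  by (metis Re_cinner zero_complex.simps(1))

lemma scaleR_eq_vector_smult: "r *\<^sub>R (x :: complex^'n) = complex_of_real r *s x"
  by (simp add: vec_eq_iff scaleR_conv_of_real[symmetric])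

lemma norm_vector_smult: "norm (c *s x) = cmod c * norm (x :: complex^'n)"
  by (simp add: norm_vec_def L2_set_right_distrib norm_mult)

lemma subspace_of_vec_subspace: "vec.subspace S \<Longrightarrow> subspace (S :: (complex^'n) set)"
  by (simp add: subspace_def vec.subspace_def scaleR_eq_vector_smult)

lemma norm_add_Pythagorean_complex:
  "cinner x y = 0 \<Longrightarrow> (norm (x + y))\<^sup>2 = (norm x)\<^sup>2 + (norm y)\<^sup>2"
  by (intro norm_add_Pythagorean) (simp add: orthogonal_def cinner_eq_0_imp_inner)

text \<open>On matrices \<open>norm\<close> is the Frobenius norm; the bound is Cauchy-Schwarz
  applied to each row. It serves the Frobenius reading of \<open>\<gamma>\<close>.\<close>

lemma norm_matrix_vector_mult_le:
  fixes M :: "complex^'n^'m"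
  shows "norm (M *v x) \<le> norm M * norm x"
proof -
  have row: "cmod ((M *v x) $ i) \<le> norm (M $ i) * norm x" for i
  proof -
    have "cmod ((M *v x) $ i) \<le> (\<Sum>j\<in>UNIV. cmod (M $ i $ j) * cmod (x $ j))"
      unfolding matrix_vector_mult_def by (simp add: norm_mult[symmetric] norm_sum)
    also have "\<dots> = (\<Sum>j\<in>UNIV. \<bar>cmod (M $ i $ j)\<bar> * \<bar>cmod (x $ j)\<bar>)" by simp
    also have "\<dots> \<le> norm (M $ i) * norm x"
      unfolding norm_vec_def by (rule L2_set_mult_ineq)
    finally show ?thesis .
  qed
  have "norm (M *v x) \<le> L2_set (\<lambda>i. norm (M $ i) * norm x) UNIV"
    unfolding norm_vec_def[of "M *v x"] using row by (intro L2_set_mono) auto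
  also have "\<dots> = norm M * norm x"
    by (simp add: L2_set_left_distrib norm_vec_def[of M])
  finally show ?thesis .
qed

section \<open>Angles between lines, and between a line and a subspace\<close>

text \<open>The residual of projecting \<open>x\<close> orthogonally onto the line of
  \<open>y\<close>. All sines of angles are computed from its norm.\<close>

definition rejection :: "complex^'n \<Rightarrow> complex^'n \<Rightarrow> complex^'n" where
  "rejection x y = x - (cinner y x / cinner y y) *s y"

lemma cinner_rejection: "cinner y (rejection x y) = 0"
  by (cases "y = 0") (simp_all add: rejection_def cinner_diff_right cinner_scale_right cinner_self)

lemma norm_rejection:
  assumes "y \<noteq> 0"
  shows "(norm x)\<^sup>2 = (cmod (cinner x y) / norm y)\<^sup>2 + (norm (rejection x y))\<^sup>2"
proof -
  let ?c = "cinner y x / cinner y y"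
  have "(norm (?c *s y + rejection x y))\<^sup>2 = (norm (?c *s y))\<^sup>2 + (norm (rejection x y))\<^sup>2"
    by (rule norm_add_Pythagorean_complex) (simp add: cinner_scale_left cinner_rejection)
  moreover have "?c *s y + rejection x y = x" by (simp add: rejection_def)
  moreover have "norm (?c *s y) = cmod (cinner x y) / norm y"
    using assms
    by (simp add: norm_vector_smult norm_divide cinner_self power2_eq_square norm_mult)
      (metis cinner_commute complex_mod_cnj)
  ultimately show ?thesis by simp
qed

text \<open>Cauchy-Schwarz, read off from Pythagoras in \<open>norm_rejection\<close>. It places the
  argument in the domain of \<open>arccos\<close>.\<close>

lemma cangle_arg_le_1: "cmod (cinner x y) / (norm x * norm y) \<le> 1"
proof (cases "x = 0 \<or> y = 0")
  case False
  have "(cmod (cinner x y) / norm y)\<^sup>2 \<le> (norm x)\<^sup>2"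
    using norm_rejection[of y x] False by simp
  then have "cmod (cinner x y) / norm y \<le> norm x"
    by (rule power2_le_imp_le) simp
  then show ?thesis using False by (simp add: field_simps)
qed auto

lemma cangle_bounds: "0 \<le> cangle x y" "cangle x y \<le> pi / 2"
proof -
  have a: "0 \<le> cmod (cinner x y) / (norm x * norm y)" by simp
  then have "- 1 \<le> cmod (cinner x y) / (norm x * norm y)" by linarith
  then show "0 \<le> cangle x y"
    unfolding cangle_def by (rule arccos_lbound[OF _ cangle_arg_le_1])
  show "cangle x y \<le> pi / 2"
    unfolding cangle_def by (rule arccos_le_pi2[OF a cangle_arg_le_1])
qed

lemma cangle_commute: "cangle x y = cangle y x"
proof -
  have "cmod (cinner x y) = cmod (cinner y x)" by (metis cinner_commute complex_mod_cnj)
  then show ?thesis by (simp add: cangle_def mult.commute)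
qed

lemma sin_cangle:
  assumes "x \<noteq> 0" "y \<noteq> 0"
  shows "sin (cangle x y) = norm (rejection x y) / norm x"
proof -
  define a where "a = cmod (cinner x y) / (norm x * norm y)"
  have "\<bar>a\<bar> \<le> 1" using cangle_arg_le_1[of x y] by (simp add: a_def)
  then have "sin (cangle x y) = sqrt (1 - a\<^sup>2)"
    unfolding cangle_def a_def by (rule sin_arccos_abs)
  also have "1 - a\<^sup>2 = (norm (rejection x y) / norm x)\<^sup>2"
  proof -
    have "(norm (rejection x y))\<^sup>2 = (norm x)\<^sup>2 - (cmod (cinner x y) / norm y)\<^sup>2"
      using norm_rejection[OF assms(2), of x] by simp
    then show ?thesis using assms
      by (simp add: a_def power_divide power_mult_distrib diff_divide_distrib mult.commute)
  qed
  finally show ?thesis by simp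
qed

text \<open>A transformation that fixes the line of \<open>x\<close> and its orthogonal complement distorts the
  tangent of the angle to \<open>x\<close> by a factor of at most \<open>c / \<bar>\<nu>\<bar>\<close>; as that factor is at least 1, the
  sine obeys the same bound.\<close>

lemma sin_cangle_transform:
  fixes C :: "complex^'n^'n"
  assumes C: "\<And>y z. cinner (C *v y) z = cinner y (C *v z)"
    and x: "x \<noteq> 0" "C *v x = \<nu> *s x" "\<nu> \<noteq> 0" and c: "\<And>z. norm (C *v z) \<le> c * norm z"
    and w: "w \<noteq> 0" "C *v w \<noteq> 0"
  shows "sin (cangle x (C *v w)) \<le> c / cmod \<nu> * sin (cangle x w)"
proof -
  define a where "a = cinner x w / cinner x x"
  define y where "y = rejection w x"
  have wy: "w = a *s x + y" by (simp add: a_def y_def rejection_def)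
  have xy: "cinner x y = 0" by (simp add: y_def cinner_rejection)
  have Cw: "C *v w = (a * \<nu>) *s x + C *v y"
    by (simp add: wy matrix_vector_right_distrib vector_scalar_commute x vector_smult_assoc)
  have xCy: "cinner x (C *v y) = 0"
    using C[of x y] xy x by (simp add: cinner_scale_left)
  have "rejection (C *v w) x = C *v y"
    using x(1) by (simp add: rejection_def Cw cinner_add_right cinner_scale_right xCy cinner_self)
  then have L: "sin (cangle x (C *v w)) = norm (C *v y) / norm (C *v w)"
    using x w by (metis cangle_commute sin_cangle)
  have R: "sin (cangle x w) = norm y / norm w"
    using x w by (metis cangle_commute sin_cangle y_def)
  have nw: "(norm w)\<^sup>2 = (cmod a * norm x)\<^sup>2 + (norm y)\<^sup>2"
    by (subst wy, subst norm_add_Pythagorean_complex)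
       (simp_all add: cinner_scale_left xy norm_vector_smult)
  have nCw: "(norm (C *v w))\<^sup>2 = (cmod a * norm x)\<^sup>2 * (cmod \<nu>)\<^sup>2 + (norm (C *v y))\<^sup>2"
    by (subst Cw, subst norm_add_Pythagorean_complex)
       (simp_all add: cinner_scale_left xCy norm_vector_smult norm_mult power_mult_distrib)
  have "cmod \<nu> * norm x \<le> c * norm x" using c[of x] by (simp add: x norm_vector_smult)
  then have nc: "cmod \<nu> \<le> c" using x by simp
  then have c0: "c \<ge> 0" using norm_ge_zero[of \<nu>] by linarith
  \<comment> \<open>The claim squared and cleared of denominators. Pythagoras splits both sides into
    two terms: those with \<open>norm x\<close> compare by the bound on \<open>C *v y\<close>, the
    others by \<open>cmod \<nu> \<le> c\<close>.\<close>
  have "(norm (C *v y))\<^sup>2 * (norm w)\<^sup>2 * (cmod \<nu>)\<^sup>2 \<le> c\<^sup>2 * (norm y)\<^sup>2 * (norm (C *v w))\<^sup>2"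
  proof -
    have 1: "(norm (C *v y))\<^sup>2 \<le> c\<^sup>2 * (norm y)\<^sup>2"
      using power_mono[OF c[of y]] by (simp add: power_mult_distrib)
    have 2: "(cmod \<nu>)\<^sup>2 \<le> c\<^sup>2" using nc by (simp add: power_mono)
    have "(norm (C *v y))\<^sup>2 * (norm y)\<^sup>2 * (cmod \<nu>)\<^sup>2 \<le> (norm (C *v y))\<^sup>2 * (norm y)\<^sup>2 * c\<^sup>2"
      using 2 by (intro mult_left_mono) auto
    moreover have "(norm (C *v y))\<^sup>2 * ((cmod a * norm x)\<^sup>2 * (cmod \<nu>)\<^sup>2)
        \<le> (c\<^sup>2 * (norm y)\<^sup>2) * ((cmod a * norm x)\<^sup>2 * (cmod \<nu>)\<^sup>2)"
      using 1 by (intro mult_right_mono) auto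
    ultimately show ?thesis unfolding nw nCw by (simp add: algebra_simps)
  qed
  then have "(norm (C *v y) * norm w * cmod \<nu>)\<^sup>2 \<le> (c * norm y * norm (C *v w))\<^sup>2"
    by (simp add: power_mult_distrib)
  then have "norm (C *v y) * norm w * cmod \<nu> \<le> c * norm y * norm (C *v w)"
    by (rule power2_le_imp_le) (simp add: c0)
  then show ?thesis using w x by (simp add: L R field_simps)
qed

text \<open>\<open>cangle_space\<close> is an infimum of angles, not of sines. The bound is
  therefore moved to angles by \<open>arcsin\<close>, taken to the infimum there, and moved back
  since sine increases up to \<open>pi / 2\<close>.\<close>

lemma sin_cangle_space_ge:
  assumes ne: "K - {0} \<noteq> {}" and "C > 0" and s: "0 \<le> s"
    and le: "\<And>u. u \<in> K \<Longrightarrow> u \<noteq> 0 \<Longrightarrow> s \<le> C * sin (cangle x u)"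
  shows "s \<le> C * sin (cangle_space x K)"
proof -
  define t where "t = s / C"
  have t: "t \<le> sin (cangle x u)" if "u \<in> K - {0}" for u
    using le[of u] that \<open>C > 0\<close> by (simp add: t_def field_simps)
  have t0: "0 \<le> t" using s \<open>C > 0\<close> by (simp add: t_def)
  obtain u where u: "u \<in> K - {0}" using ne by auto
  have t1: "t \<le> 1" using t[OF u] sin_le_one[of "cangle x u"] by linarith
  have "arcsin t \<le> cangle_space x K"
    unfolding cangle_space_def
  proof (rule cINF_greatest[OF ne])
    fix u assume u: "u \<in> K - {0}"
    have "arcsin t \<le> arcsin (sin (cangle x u))"
      using t[OF u] t0 by (intro arcsin_le_arcsin) auto
    also have "\<dots> = cangle x u"
      using cangle_bounds[of x u] by (intro arcsin_sin) auto
    finally show "arcsin t \<le> cangle x u" .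
  qed
  moreover have "cangle_space x K \<le> pi / 2"
  proof -
    have "cangle_space x K \<le> cangle x u"
      unfolding cangle_space_def using u
      by (intro cINF_lower bdd_belowI2[of _ 0] cangle_bounds)
    then show ?thesis using cangle_bounds(2)[of x u] by linarith
  qed
  moreover have "- (pi / 2) \<le> arcsin t" using t0 t1 by (intro arcsin_lbound) auto
  ultimately have "sin (arcsin t) \<le> sin (cangle_space x K)"
    by (intro sin_monotone_2pi_le) auto
  then show ?thesis using t0 t1 \<open>C > 0\<close> by (simp add: t_def field_simps)
qed

section \<open>Orthogonal projectors and the bound for Ritz vectors\<close>

lemma
  assumes "orthogonal_projector P Q"
  shows projector_mem: "P *v y \<in> Q"
    and projector_fix: "q \<in> Q \<Longrightarrow> P *v q = q"
    and projector_cinner: "q \<in> Q \<Longrightarrow> cinner q (P *v y) = cinner q y"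
proof -
  have PP: "P *v (P *v y) = P *v y" for y
    using assms by (simp add: orthogonal_projector_def matrix_vector_mul_assoc)
  have R: "range ((*v) P) = Q" and H: "hermitian P"
    using assms by (simp_all add: orthogonal_projector_def)
  show "P *v y \<in> Q" using R by auto
  show pfix: "P *v q = q" if "q \<in> Q" for q using that R PP by auto
  show "cinner q (P *v y) = cinner q y" if "q \<in> Q"
    using cinner_hermitian[OF H, of q y] pfix[OF that] by simp
qed

text \<open>Saad's bound for Ritz vectors. With \<open>Q' = {z \<in> Q. z \<perp> w}\<close>, write \<open>x = a w + z + u\<close> where
  \<open>z \<in> Q'\<close> and \<open>u = (I - P) x\<close>. The \<open>Q'\<close>-component of \<open>P (T - \<tau>) x = 0\<close> bounds
  \<open>(P T - \<tau>) z\<close> by \<open>P T u\<close>, while \<open>P T\<close> is symmetric on \<open>Q'\<close> with eigenvalues away from \<open>\<tau>\<close>.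
  The constant \<open>e\<close> stands for \<open>\<gamma> / \<delta>\<close>.\<close>

lemma ritz_vector_bound:
  fixes T P :: "complex^'n^'n" and \<tau> e \<gamma> :: real
  assumes T: "\<And>y z. cinner (T *v y) z = cinner y (T *v z)"
    and P: "orthogonal_projector P Q" and Q: "vec.subspace Q"
    and w: "w \<in> Q" "P *v (T *v w) = \<omega> *s w"
    and x: "T *v x = complex_of_real \<tau> *s x"
    and \<gamma>: "norm (P *v (T *v (x - P *v x))) \<le> \<gamma> * norm (x - P *v x)"
    and gap: "\<And>z r. z \<in> Q \<Longrightarrow> z \<noteq> 0 \<Longrightarrow> cinner w z = 0 \<Longrightarrow> P *v (T *v z) = complex_of_real r *s z
        \<Longrightarrow> r \<noteq> \<tau> \<and> \<gamma> \<le> e * \<bar>r - \<tau>\<bar>"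
    and e: "0 \<le> e"
  shows "norm (rejection x w) \<le> sqrt (1 + e\<^sup>2) * norm (x - P *v x)"
proof -
  define Q' where "Q' = {z \<in> Q. cinner w z = 0}"
  define f where "f = (\<lambda>z. P *v (T *v z) - \<tau> *\<^sub>R z)"
  define u where "u = x - P *v x"
  define z where "z = rejection (P *v x) w"
  define a where "a = cinner w x / cinner w w"
  note mem = projector_mem[OF P] and pc = projector_cinner[OF P]
  have S: "subspace Q'"
    using subspace_of_vec_subspace[OF Q]
    by (auto simp: Q'_def subspace_def cinner_add_right scaleR_eq_vector_smult cinner_scale_right)
  have PT: "cinner y (P *v (T *v y')) = cinner (P *v (T *v y)) y'" if "y \<in> Q" "y' \<in> Q" for y y'
  proof -
    have "cinner (P *v (T *v y)) y' = cinner (T *v y) y'"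
      using pc[OF that(2), of "T *v y"] by (metis cinner_commute)
    then show ?thesis using pc[OF that(1)] by (simp add: T)
  qed
  \<comment> \<open>The compression of \<open>T\<close> to \<open>Q\<close> is symmetric and has
    \<open>w\<close> as an eigenvector, so it preserves the complement \<open>Q'\<close> of
    \<open>w\<close> in \<open>Q\<close>.\<close>
  have wf: "cinner w (P *v (T *v y)) = 0" if "y \<in> Q'" for y
    using that PT[OF w(1), of y] by (simp add: Q'_def w(2) cinner_scale_left)
  have lin: "linear f"
    unfolding f_def
    by (intro linear_compose_sub linear_scaleR
        linear_compose[unfolded o_def, of "(*v) T" "(*v) P"] bounded_linear.linear
        matrix_vector_mul_bounded_linear)
  have inv: "f y \<in> Q'" if "y \<in> Q'" for y
    using that wf[OF that] mem subspace_of_vec_subspace[OF Q]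
    by (auto simp: f_def Q'_def cinner_diff_right scaleR_eq_vector_smult cinner_scale_right
        subspace_diff vec.subspace_scale[OF Q])
  have sym: "f y \<bullet> y' = y \<bullet> f y'" if "y \<in> Q'" "y' \<in> Q'" for y y'
  proof -
    have "(P *v (T *v y)) \<bullet> y' = y \<bullet> (P *v (T *v y'))"
      using PT[of y y'] that by (simp add: Q'_def flip: Re_cinner)
    then show ?thesis by (simp add: f_def inner_diff_left inner_diff_right)
  qed
  have wPx: "cinner w (P *v x) = cinner w x" using pc[OF w(1)] .
  have Px: "P *v x = a *s w + z" by (simp add: z_def rejection_def a_def wPx)
  have zQ': "z \<in> Q'"
    using mem w(1) cinner_rejection[of w "P *v x"] vec.subspace_diff[OF Q] vec.subspace_scale[OF Q]
    by (simp add: Q'_def z_def) (simp add: rejection_def)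
  have rej: "rejection x w = z + u"
    by (simp add: z_def u_def rejection_def wPx)
  have zu: "cinner z u = 0"
    using pc[of z x] zQ' by (simp add: Q'_def u_def cinner_diff_right)
  have PTu: "P *v (T *v u) = (a * (\<tau> - \<omega>)) *s w + (- f z)"
  proof -
    have "P *v (T *v u) = P *v (T *v x) - P *v (T *v (P *v x))"
      by (simp add: u_def matrix_vector_mult_diff_distrib)
    also have "P *v (T *v x) = complex_of_real \<tau> *s (a *s w + z)"
      by (simp add: x vector_scalar_commute Px[symmetric])
    also have "P *v (T *v (P *v x)) = (a * \<omega>) *s w + P *v (T *v z)"
      by (simp add: Px matrix_vector_right_distrib vector_scalar_commute w(2) vector_smult_assoc)
    finally show ?thesis
      by (simp add: f_def scaleR_eq_vector_smult vec_eq_iff algebra_simps)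
  qed
  have "cinner w (f z) = 0" using inv[OF zQ'] by (simp add: Q'_def)
  then have "cinner w (- f z) = 0"
    by (metis cinner_diff_right cinner_zero_right diff_0 minus_zero)
  then have "(norm (P *v (T *v u)))\<^sup>2 = (norm ((a * (\<tau> - \<omega>)) *s w))\<^sup>2 + (norm (- f z))\<^sup>2"
    unfolding PTu by (intro norm_add_Pythagorean_complex) (simp add: cinner_scale_left)
  then have "(norm (f z))\<^sup>2 \<le> (norm (P *v (T *v u)))\<^sup>2" by simp
  then have "norm (f z) \<le> norm (P *v (T *v u))" by (rule power2_le_imp_le) simp
  then have fz: "norm (f z) \<le> \<gamma> * norm u" using \<gamma> by (simp add: u_def)
  have zu_le: "norm z \<le> e * norm u"
  proof (cases "Q' = {0}")
    case True
    then show ?thesis using zQ' e by simp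
  next
    case False
    obtain z' r where z': "z' \<in> Q'" "z' \<noteq> 0" "f z' = r *\<^sub>R z'"
      and r: "\<And>y. y \<in> Q' \<Longrightarrow> \<bar>r\<bar> * norm y \<le> norm (f y)"
      using symmetric_eigen_norm_lower[OF lin S inv sym False] by blast
    \<comment> \<open>The eigenvalue \<open>r\<close> of \<open>f\<close> belongs to the Ritz value
      \<open>r + \<tau>\<close>, so \<open>\<bar>r\<bar>\<close> is its distance from
      \<open>\<tau>\<close>, which \<open>gap\<close> controls.\<close>
    have "P *v (T *v z') = (r + \<tau>) *\<^sub>R z'"
      using z'(3) by (simp add: f_def algebra_simps)
    then have g: "r \<noteq> 0" "\<gamma> \<le> e * \<bar>r\<bar>"
      using gap[of z' "r + \<tau>"] z' by (auto simp: Q'_def scaleR_eq_vector_smult)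
    have "\<bar>r\<bar> * norm z \<le> \<gamma> * norm u" using r[OF zQ'] fz by linarith
    also have "\<dots> \<le> e * \<bar>r\<bar> * norm u" using g by (intro mult_right_mono) auto
    finally have "\<bar>r\<bar> * norm z \<le> \<bar>r\<bar> * (e * norm u)" by (simp add: mult_ac)
    then show ?thesis using g by simp
  qed
  have "(norm (rejection x w))\<^sup>2 = (norm z)\<^sup>2 + (norm u)\<^sup>2"
    unfolding rej by (rule norm_add_Pythagorean_complex[OF zu])
  also have "\<dots> \<le> (e * norm u)\<^sup>2 + (norm u)\<^sup>2"
    using power_mono[OF zu_le, of 2] by simp
  also have "\<dots> = (sqrt (1 + e\<^sup>2) * norm u)\<^sup>2"
    by (simp add: power_mult_distrib algebra_simps)
  finally show ?thesis unfolding u_def by (rule power2_le_imp_le) simp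
qed

text \<open>Best approximation: \<open>x - P *v x\<close> is orthogonal to
  \<open>P *v x - q\<close>, which lies in \<open>Q\<close>, so Pythagoras applies.\<close>

lemma norm_projector_residual_le:
  assumes "orthogonal_projector P Q" "vec.subspace Q" "q \<in> Q"
  shows "norm (x - P *v x) \<le> norm (x - q)"
proof (rule power2_le_imp_le)
  have d: "P *v x - q \<in> Q"
    using projector_mem[OF assms(1)] vec.subspace_diff[OF assms(2) _ assms(3)] by blast
  have "cinner (P *v x - q) (x - P *v x) = 0"
    using projector_cinner[OF assms(1) d, of x] by (simp add: cinner_diff_right)
  from norm_add_Pythagorean_complex[OF this]
  show "(norm (x - P *v x))\<^sup>2 \<le> (norm (x - q))\<^sup>2" by simp
qed simp

section \<open>Eigenvalues, inverse, Ritz gaps and norm bounds of the shifted matrix\<close>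

lemma hermitian_eigenvalue_real:
  assumes "hermitian A" "eigenpair A l x"
  shows "l = complex_of_real (Re l)"
proof -
  have "cnj l * cinner x x = l * cinner x x"
    using cinner_hermitian[OF assms(1), of x x] assms(2)
    by (simp add: eigenpair_def cinner_scale_left cinner_scale_right)
  then have "cnj l = l" using assms(2) by (simp add: eigenpair_def cinner_self)
  then show ?thesis by (simp add: complex_eq_iff)
qed

lemma shifted_inverse:
  fixes A :: "complex^'n^'n"
  assumes "complex_of_real \<sigma> \<notin> spectrum A"
  shows "shifted A \<sigma> *v (matrix_inv (shifted A \<sigma>) *v y) = y"
    and "matrix_inv (shifted A \<sigma>) *v (shifted A \<sigma> *v y) = y"
proof -
  let ?B = "shifted A \<sigma>"
  have "\<forall>x. ?B *v x = 0 \<longrightarrow> x = 0"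
    using assms by (auto simp: shifted_mult spectrum_def eigenpair_def)
  then have "invertible ?B"
    by (simp add: matrix_left_invertible_ker[symmetric] invertible_left_inverse)
  then have "?B ** matrix_inv ?B = mat 1 \<and> matrix_inv ?B ** ?B = mat 1"
    unfolding invertible_def matrix_inv_def by (rule someI_ex)
  then show "?B *v (matrix_inv ?B *v y) = y" "matrix_inv ?B *v (?B *v y) = y"
    by (simp_all add: matrix_vector_mul_assoc)
qed

text \<open>The Ritz values of \<open>(A - \<sigma> I)\<^sup>-\<^sup>1\<close> with respect to \<open>(A - \<sigma> I) K\<close> are the numbers
  \<open>1 / (\<theta> - \<sigma>)\<close>, with 0 for the harmonic Ritz value at infinity. If \<open>z\<close> belongs to the same
  value as \<open>v\<close>, then that value has multiplicity at least 2, so one copy survives the removal.\<close>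

lemma ritz_separation_le:
  fixes A P :: "complex^'n^'n" and K :: "(complex^'n) set" and r :: real
  assumes A: "hermitian A" and l: "l \<noteq> complex_of_real \<sigma>"
    and \<sigma>: "complex_of_real \<sigma> \<notin> spectrum A"
    and v: "harmonic_ritz_pair A \<sigma> K \<theta> v"
    and P: "orthogonal_projector P ((*v) (shifted A \<sigma>) ` K)"
    and z: "z \<in> (*v) (shifted A \<sigma>) ` K" "z \<noteq> 0" "cinner (shifted A \<sigma> *v v) z = 0"
      "P *v (matrix_inv (shifted A \<sigma>) *v z) = complex_of_real r *s z"
  shows "ritz_separation A \<sigma> K l \<theta> \<le> ereal (cmod (complex_of_real r - 1 / (l - complex_of_real \<sigma>)))"
proof -
  define B where "B = shifted A \<sigma>"
  define t where "t = (if r = 0 then Infinite else Finite (complex_of_real (\<sigma> + 1 / r)))"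
  obtain k where k: "k \<in> K" "z = B *v k" using z(1) by (auto simp: B_def)
  have Tz: "matrix_inv B *v z = k"
    unfolding k(2) B_def by (rule shifted_inverse(2)[OF \<sigma>])
  have k0: "k \<noteq> 0" using z(2) k(2) by auto
  have orth: "cinner q k = complex_of_real r * cinner q z" if "q \<in> (*v) B ` K" for q
    using projector_cinner[OF P, of q k] that z(4) Tz
    by (simp add: B_def cinner_scale_right)
  have kt: "k \<in> harmonic_ritz_space A \<sigma> K t"
  proof (cases "r = 0")
    case True
    then show ?thesis using k orth by (auto simp: t_def B_def)
  next
    case False
    have "cinner (B *v y) (B *v k) = complex_of_real (1 / r) * cinner (B *v y) k" if "y \<in> K" for y
      using orth[of "B *v y"] that False k(2) by simp
    then have "harmonic_ritz_pair A \<sigma> K (complex_of_real (\<sigma> + 1 / r)) k"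
      using k k0 by (simp add: harmonic_ritz_pair_iff B_def)
    then show ?thesis using False by (simp add: t_def)
  qed
  have "count {#Finite \<theta>#} t < vec.dim (harmonic_ritz_space A \<sigma> K t)"
  proof (cases "t = Finite \<theta>")
    case False
    have "vec.independent {k}" using k0 by simp
    then have "1 \<le> vec.dim (harmonic_ritz_space A \<sigma> K t)"
      using vec.independent_card_le_dim[of "{k}"] kt by simp
    then show ?thesis using False by simp
  next
    case True
    have v0: "v \<noteq> 0" and vt: "v \<in> harmonic_ritz_space A \<sigma> K t"
      using v True by (auto simp: harmonic_ritz_pair_def)
    \<comment> \<open>The images of \<open>k\<close> and \<open>v\<close> under \<open>B\<close> are
      orthogonal and that of \<open>k\<close> is nonzero, so \<open>k\<close> is not a multiple of
      \<open>v\<close>.\<close>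
    have "k \<notin> vec.span {v}"
    proof
      assume "k \<in> vec.span {v}"
      then obtain c where "k = c *s v" by (auto simp: vec.span_singleton)
      then have zc: "z = c *s (B *v v)" by (simp add: k(2) vector_scalar_commute)
      then have "c * cinner (B *v v) (B *v v) = 0"
        using z(3) by (simp add: B_def cinner_scale_right)
      then have "c = 0 \<or> B *v v = 0" by (simp add: cinner_self)
      then show False using zc z(2) by auto
    qed
    then have "vec.independent {k, v}" "k \<noteq> v"
      using v0 by (auto simp: vec.independent_insert vec.span_base)
    then have "2 \<le> vec.dim (harmonic_ritz_space A \<sigma> K t)"
      using vec.independent_card_le_dim[of "{k, v}" "harmonic_ritz_space A \<sigma> K t"] kt vt by simp
    then show ?thesis using True by simp
  qed
  then have "t \<in># harmonic_ritz_values A \<sigma> K - {#Finite \<theta>#}"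
    by (metis count_harmonic_ritz_values[OF A \<sigma>] in_diff_count)
  then have "ritz_separation A \<sigma> K l \<theta> \<le> ereal (ritz_gap l \<sigma> t)"
    unfolding ritz_separation_def by (rule INF_lower)
  \<comment> \<open>The gap is a distance between reciprocals: \<open>(\<theta> - l) / ((l -
    \<sigma>) (\<theta> - \<sigma>)) = 1 / (l - \<sigma>) - 1 / (\<theta> - \<sigma>)\<close>, and
    here \<open>r = 1 / (\<theta> - \<sigma>)\<close>, or 0 at infinity.\<close>
  also have "ritz_gap l \<sigma> t = cmod (complex_of_real r - 1 / (l - complex_of_real \<sigma>))"
  proof (cases "r = 0")
    case True
    then show ?thesis by (simp add: t_def norm_divide)
  next
    case False
    define \<mu> where "\<mu> = l - complex_of_real \<sigma>"
    have "\<mu> \<noteq> 0" using l by (simp add: \<mu>_def)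
    have "complex_of_real (\<sigma> + 1 / r) - l = 1 / complex_of_real r - \<mu>"
      "complex_of_real (\<sigma> + 1 / r) - complex_of_real \<sigma> = 1 / complex_of_real r"
      by (simp_all add: \<mu>_def)
    then have "ritz_gap l \<sigma> t = cmod ((1 / complex_of_real r - \<mu>) / (\<mu> * (1 / complex_of_real r)))"
      using False by (simp only: t_def if_False ritz_gap.simps \<mu>_def)
    also have "(1 / complex_of_real r - \<mu>) / (\<mu> * (1 / complex_of_real r)) = 1 / \<mu> - complex_of_real r"
      using False \<open>\<mu> \<noteq> 0\<close> by (simp add: field_simps)
    finally show ?thesis by (simp add: norm_minus_commute \<mu>_def)
  qed
  finally show ?thesis .
qed

lemma ritz_separation_nonneg: "0 \<le> ritz_separation A \<sigma> K l \<theta>"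
proof -
  have "0 \<le> ritz_gap l \<sigma> t" for t by (cases t) simp_all
  then show ?thesis by (simp add: ritz_separation_def INF_greatest)
qed

text \<open>The vectors of least and greatest stretching are eigenvectors of the Hermitian matrix
  \<open>shifted A \<sigma>\<close>, so both stretching factors lie in \<open>D\<close>, between
  \<open>Min D\<close> and \<open>Max D\<close>.\<close>

lemma shifted_norm_bounds:
  fixes A :: "complex^'n^'n"
  assumes A: "hermitian A" and \<sigma>: "complex_of_real \<sigma> \<notin> spectrum A"
  defines "D \<equiv> (\<lambda>\<mu>. cmod (\<mu> - complex_of_real \<sigma>)) ` spectrum A"
  shows "0 < Min D" and "Min D * norm y \<le> norm (shifted A \<sigma> *v y)"
    and "norm (shifted A \<sigma> *v y) \<le> Max D * norm y"
proof -
  let ?f = "(*v) (shifted A \<sigma>)"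
  have fin: "finite D" unfolding D_def using finite_spectrum[OF A] by simp
  have sym: "?f x \<bullet> y = x \<bullet> ?f y" for x y
    using cinner_hermitian[OF hermitian_shifted[OF A, of \<sigma>], of x y] by (metis Re_cinner)
  have lin: "linear ?f" by (rule bounded_linear.linear) simp
  have "axis undefined 1 \<noteq> (0 :: complex^'n)" by (simp add: axis_eq_0_iff)
  then have ne: "(UNIV :: (complex^'n) set) \<noteq> {0}" by blast
  have eig: "\<bar>r\<bar> \<in> D" if "z \<noteq> 0" "?f z = r *\<^sub>R z" for z and r :: real
  proof -
    have "A *v z = (complex_of_real r + complex_of_real \<sigma>) *s z"
      using that(2) by (simp add: shifted_mult scaleR_eq_vector_smult vec_eq_iff algebra_simps)
    then have "complex_of_real r + complex_of_real \<sigma> \<in> spectrum A"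
      using that(1) by (auto simp: spectrum_def eigenpair_def)
    then show ?thesis unfolding D_def by (rule rev_image_eqI) simp
  qed
  obtain z r where z: "z \<noteq> 0" "?f z = r *\<^sub>R z"
    and lo: "\<And>y. \<bar>r\<bar> * norm y \<le> norm (?f y)"
    by (rule symmetric_eigen_norm_lower[OF lin subspace_UNIV _ sym ne]) auto
  have rD: "\<bar>r\<bar> \<in> D" using eig[OF z] .
  then have "Min D \<in> D" using fin by (intro Min_in) auto
  then show "0 < Min D" using \<sigma> by (auto simp: D_def)
  have "Min D * norm y \<le> \<bar>r\<bar> * norm y"
    using Min_le[OF fin rD] by (intro mult_right_mono) auto
  then show "Min D * norm y \<le> norm (?f y)" using lo[of y] by linarith
  obtain z' r' where z': "z' \<noteq> 0" "?f z' = r' *\<^sub>R z'"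
    and up: "\<And>y. norm (?f y) \<le> \<bar>r'\<bar> * norm y"
    by (rule symmetric_eigen_norm_upper[OF lin subspace_UNIV _ sym ne]) auto
  have "\<bar>r'\<bar> * norm y \<le> Max D * norm y"
    using Max_ge[OF fin eig[OF z']] by (intro mult_right_mono) auto
  then show "norm (?f y) \<le> Max D * norm y" using up[of y] by linarith
qed

section \<open>Transfer of the Ritz bound for the inverse to harmonic Ritz vectors\<close>

theorem theorem3:
  fixes A P :: "complex^'n^'n" and x v :: "complex^'n" and K :: "(complex^'n) set"
    and l \<theta> :: complex and \<sigma> \<gamma> :: real and \<delta> :: ereal
  assumes "hermitian A"
    and "eigenpair A l x"
    and "vec.subspace K"
    and "complex_of_real \<sigma> \<notin> spectrum A"
    and "harmonic_ritz_pair A \<sigma> K \<theta> v"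
    and "orthogonal_projector P ((*v) (shifted A \<sigma>) ` K)"
    and "\<gamma> \<in> {onorm ((*v) (P ** matrix_inv (shifted A \<sigma>) ** (mat 1 - P))),
               norm (P ** matrix_inv (shifted A \<sigma>) ** (mat 1 - P))}"
    and "\<delta> = ritz_separation A \<sigma> K l \<theta>"
    and "\<delta> \<noteq> 0"
  shows "sin (cangle x v) \<le>
    kappa_shifted A \<sigma> * sqrt (1 + real_of_ereal (ereal (\<gamma>\<^sup>2) / \<delta>\<^sup>2)) * sin (cangle_space x K)"
proof -
  define B where "B = shifted A \<sigma>"
  define T where "T = matrix_inv B"
  define Q where "Q = (*v) B ` K"
  define w where "w = B *v v"
  define \<mu> where "\<mu> = Re l - \<sigma>"
  define D where "D = (\<lambda>\<mu>. cmod (\<mu> - complex_of_real \<sigma>)) ` spectrum A"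
  define m where "m = Min D"
  define M where "M = Max D"
  note P = assms(6)[folded B_def, folded Q_def]
  have BT: "B *v (T *v y) = y" and TB: "T *v (B *v y) = y" for y
    unfolding T_def B_def by (rule shifted_inverse[OF assms(4)])+
  have B: "cinner (B *v y) z = cinner y (B *v z)" for y z
    unfolding B_def by (rule cinner_hermitian[OF hermitian_shifted[OF assms(1)]])
  have T: "cinner (T *v y) z = cinner y (T *v z)" for y z
    using B[of "T *v y" "T *v z"] by (simp add: BT)
  have m: "0 < m" and lo: "m * norm y \<le> norm (B *v y)" and up: "norm (B *v y) \<le> M * norm y" for y
    unfolding m_def M_def B_def D_def by (rule shifted_norm_bounds[OF assms(1,4)])+
  have x0: "x \<noteq> 0" and Ax: "A *v x = l *s x" using assms(2) by (simp_all add: eigenpair_def)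
  have l: "l = complex_of_real (Re l)" by (rule hermitian_eigenvalue_real[OF assms(1,2)])
  have l\<mu>: "l - complex_of_real \<sigma> = complex_of_real \<mu>" by (subst l) (simp add: \<mu>_def)
  have "l \<in> spectrum A" using assms(2) by (auto simp: spectrum_def)
  with assms(4) have l\<sigma>: "l \<noteq> complex_of_real \<sigma>" by auto
  with l\<mu> have \<mu>0: "\<mu> \<noteq> 0" by auto
  have Bx: "B *v x = complex_of_real \<mu> *s x"
    by (simp add: B_def shifted_mult Ax l\<mu>[symmetric] vec_eq_iff algebra_simps)
  have Tx: "T *v x = complex_of_real (1 / \<mu>) *s x"
  proof -
    have "x = complex_of_real \<mu> *s (T *v x)"
      using TB[of x] by (simp add: Bx vector_scalar_commute)
    then show ?thesis using \<mu>0 by (metis (no_types, lifting) of_real_1 of_real_mult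
          vector_smult_assoc vector_smult_lid nonzero_eq_divide_eq mult.commute)
  qed
  have M: "0 < M" using up[of x] x0 \<mu>0 by (simp add: Bx norm_vector_smult)

  have v: "v \<in> K" "v \<noteq> 0" and vr: "\<And>y. y \<in> K \<Longrightarrow>
      cinner (B *v y) w = (\<theta> - complex_of_real \<sigma>) * cinner (B *v y) v"
    using assms(5) by (simp_all add: harmonic_ritz_pair_iff B_def w_def)
  have wQ: "w \<in> Q" using v by (simp add: w_def Q_def)
  have w0: "w \<noteq> 0" using v TB[of v] by (auto simp: w_def)
  have Q: "vec.subspace Q"
    unfolding Q_def by (intro vec.linear_subspace_image matrix_vector_mul_linear_gen assms(3))
  have Tw: "T *v w = v" by (simp add: w_def TB)
  \<comment> \<open>Testing the harmonic condition with \<open>v\<close> itself equates the squared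
    norm of \<open>w\<close>, which is nonzero, with a multiple of
    \<open>\<theta> - \<sigma>\<close>.\<close>
  have \<xi>0: "\<theta> - complex_of_real \<sigma> \<noteq> 0"
    using vr[OF v(1)] w0 by (auto simp: w_def[symmetric] cinner_self)
  have PTw: "P *v (T *v w) = (1 / (\<theta> - complex_of_real \<sigma>)) *s w" (is "_ = ?\<omega> *s w")
  proof -
    \<comment> \<open>By the harmonic condition \<open>v\<close> and \<open>?\<omega> *s w\<close>
      have the same inner products with \<open>Q\<close>. As \<open>?d\<close> lies in
      \<open>Q\<close>, it is orthogonal to itself.\<close>
    let ?d = "P *v v - ?\<omega> *s w"
    have dQ: "?d \<in> Q"
      by (intro vec.subspace_diff[OF Q] vec.subspace_scale[OF Q] wQ projector_mem[OF P])
    then obtain y where y: "y \<in> K" "?d = B *v y" by (auto simp: Q_def)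
    have "cinner ?d ?d = cinner ?d v - ?\<omega> * cinner ?d w"
      using projector_cinner[OF P dQ, of v] by (simp add: cinner_diff_right cinner_scale_right)
    also have "\<dots> = 0" unfolding y(2) vr[OF y(1)] using \<xi>0 by simp
    finally have "?d = 0" by (simp add: cinner_self)
    then show ?thesis by (simp add: Tw)
  qed

  let ?N = "P ** T ** (mat 1 - P)"
  \<comment> \<open>The only property of \<open>\<gamma>\<close> used below; it covers the spectral
    and the Frobenius norm at once.\<close>
  have \<gamma>le: "norm (?N *v y) \<le> \<gamma> * norm y" for y
  proof -
    have "norm (?N *v y) \<le> onorm ((*v) ?N) * norm y"
      by (rule onorm) simp
    moreover note norm_matrix_vector_mult_le[of ?N y]
    ultimately show ?thesis using assms(7) unfolding T_def B_def by blast
  qed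
  have \<gamma>: "norm (P *v (T *v (x - P *v x))) \<le> \<gamma> * norm (x - P *v x)"
  proof -
    let ?u = "x - P *v x"
    have "P *v ?u = 0"
      by (simp add: matrix_vector_mult_diff_distrib projector_fix[OF P projector_mem[OF P]])
    then have "?N *v ?u = P *v (T *v ?u)"
      by (simp add: matrix_vector_mul_assoc[symmetric] matrix_vector_mult_diff_rdistrib)
    then show ?thesis using \<gamma>le[of ?u] by simp
  qed
  have \<gamma>0: "0 \<le> \<gamma>"
    using \<gamma>le[of x] norm_ge_zero[of "?N *v x"] x0 by (meson norm_ge_zero order_trans
        zero_le_mult_iff zero_less_norm_iff linorder_not_le)

  have sep: "\<delta> \<le> ereal \<bar>r - 1 / \<mu>\<bar>"
    if "z \<in> Q" "z \<noteq> 0" "cinner w z = 0" "P *v (T *v z) = complex_of_real r *s z" for z r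
  proof -
    have "cmod (complex_of_real r - 1 / complex_of_real \<mu>) = \<bar>r - 1 / \<mu>\<bar>"
      by (metis norm_of_real of_real_1 of_real_diff of_real_divide)
    then show ?thesis
      using ritz_separation_le[OF assms(1) l\<sigma> assms(4,5,6), of z r] that
      unfolding Q_def B_def w_def T_def assms(8) l\<mu>[unfolded B_def] by simp
  qed
  \<comment> \<open>For finite \<open>\<delta>\<close>, which is then positive,
    \<open>e = \<gamma> / \<delta>\<close>. For \<open>\<delta> = \<infinity>\<close> the quotient
    is 0 and \<open>e = 0\<close>; then \<open>sep\<close> shows that no \<open>z\<close> meets the
    premises of \<open>gap\<close>.\<close>
  obtain e where e: "0 \<le> e" "e\<^sup>2 = real_of_ereal (ereal (\<gamma>\<^sup>2) / \<delta>\<^sup>2)"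
    and gap: "\<And>z r. z \<in> Q \<Longrightarrow> z \<noteq> 0 \<Longrightarrow> cinner w z = 0 \<Longrightarrow>
        P *v (T *v z) = complex_of_real r *s z \<Longrightarrow> r \<noteq> 1 / \<mu> \<and> \<gamma> \<le> e * \<bar>r - 1 / \<mu>\<bar>"
  proof (cases \<delta>)
    case (real d)
    have d: "0 < d"
      using ritz_separation_nonneg[of A \<sigma> K l \<theta>, folded assms(8)] assms(9)
      unfolding real by simp
    have "r \<noteq> 1 / \<mu> \<and> \<gamma> \<le> \<gamma> / d * \<bar>r - 1 / \<mu>\<bar>"
      if "z \<in> Q" "z \<noteq> 0" "cinner w z = 0" "P *v (T *v z) = complex_of_real r *s z" for z r
    proof -
      have dr: "d \<le> \<bar>r - 1 / \<mu>\<bar>" using sep[OF that] real by simp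
      then have "\<gamma> * d \<le> \<gamma> * \<bar>r - 1 / \<mu>\<bar>" using \<gamma>0 by (rule mult_left_mono)
      then show ?thesis using d dr by (auto simp: field_simps)
    qed
    then show thesis
      using that[of "\<gamma> / d"] d \<gamma>0 real by (simp add: power_divide power2_eq_square)
  next
    case PInf
    then show thesis using that[of 0] sep by (force simp: power2_eq_square)
  next
    case MInf
    then show thesis using ritz_separation_nonneg[of A \<sigma> K l \<theta>] assms(8) by simp
  qed
  define C where "C = sqrt (1 + e\<^sup>2)"
  have C: "0 < C" unfolding C_def by (simp add: add_pos_nonneg)
  have "norm (rejection x w) \<le> C * norm (x - P *v x)"
    unfolding C_def by (rule ritz_vector_bound[OF T P Q wQ PTw Tx \<gamma> gap e(1)])
  then have saad: "sin (cangle x w) \<le> C * (norm (x - P *v x) / norm x)"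
    using x0 w0 by (simp add: sin_cangle divide_right_mono)
  \<comment> \<open>The transformation is \<open>T\<close>, with norm bound \<open>1 / m\<close> and
    eigenvalue \<open>1 / \<mu>\<close> at \<open>x\<close>.\<close>
  have xv: "sin (cangle x v) \<le> \<bar>\<mu>\<bar> / m * sin (cangle x w)"
  proof -
    have "norm (T *v z) \<le> (1 / m) * norm z" for z
      using lo[of "T *v z"] m by (simp add: BT field_simps)
    from sin_cangle_transform[OF T x0 Tx _ this w0]
    show ?thesis using \<mu>0 v by (simp add: Tw norm_divide)
  qed
  have QK: "norm (x - P *v x) / norm x \<le> M / \<bar>\<mu>\<bar> * sin (cangle x u)" if u: "u \<in> K" "u \<noteq> 0" for u
  proof -
    have Bu: "B *v u \<noteq> 0" using TB[of u] u by auto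
    have "B *v u \<in> Q" using u by (simp add: Q_def)
    \<comment> \<open>The projection of \<open>x\<close> onto the line of \<open>B *v u\<close> is
      one element of \<open>Q\<close>, hence no closer to \<open>x\<close> than
      \<open>P *v x\<close>.\<close>
    then have "norm (x - P *v x) \<le> norm (rejection x (B *v u))"
      unfolding rejection_def
      by (intro norm_projector_residual_le[OF P Q] vec.subspace_scale[OF Q])
    then have "norm (x - P *v x) / norm x \<le> sin (cangle x (B *v u))"
      using x0 Bu by (simp add: sin_cangle divide_right_mono)
    also have "\<dots> \<le> M / \<bar>\<mu>\<bar> * sin (cangle x u)"
      using sin_cangle_transform[OF B x0 Bx _ up u(2) Bu] \<mu>0 by simp
    finally show ?thesis .
  qed
  have "norm (x - P *v x) / norm x \<le> M / \<bar>\<mu>\<bar> * sin (cangle_space x K)"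
    by (rule sin_cangle_space_ge) (use v M \<mu>0 QK in auto)
  then have "C * (norm (x - P *v x) / norm x) \<le> C * (M / \<bar>\<mu>\<bar> * sin (cangle_space x K))"
    using C by (intro mult_left_mono) auto
  with saad have "sin (cangle x w) \<le> C * (M / \<bar>\<mu>\<bar> * sin (cangle_space x K))" by linarith
  then have "\<bar>\<mu>\<bar> / m * sin (cangle x w) \<le> \<bar>\<mu>\<bar> / m * (C * (M / \<bar>\<mu>\<bar> * sin (cangle_space x K)))"
    using m by (intro mult_left_mono) auto
  also have "\<dots> = M / m * C * sin (cangle_space x K)" using \<mu>0 m by simp
  also have "M / m = kappa_shifted A \<sigma>"
    by (simp add: kappa_shifted_def M_def m_def D_def)
  finally show ?thesis using xv by (simp add: C_def e(2))
qed

end
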